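(* Let $\Delta,\Gamma$ be compatible visibility functions and $P,Q$ closed image-finite processes with $\Delta\vdash P$ and $\Delta\vdash Q$. If $P$ and $Q$ are barbed equivalent at $\Gamma$, then $P\approx^{\Delta}_{\Gamma}Q$ (typed bisimilarity under $\Gamma$).
   Context: Calculus. Names are partitioned into higher-order names $a,b,c,\dots$ (set $N_{ho}$), first-order names $h,k$, success names $\omega$; first-order values $v$, variables $x$, expressions $e,f$ (closed ones evaluate: $e\Downarrow v$). Processes: $P::= a(x,b).P \mid h(x).P \mid \overline{a}\langle e\rangle(b).P \mid \overline{h}\langle e\rangle.P \mid \omega.P \mid\ !\alpha.P \mid P|Q \mid \nu a\,P \mid \nu h\,P \mid 0 \mid P+Q \mid \mathtt{if}\ e=f\ \mathtt{then}\ P\ \mathtt{else}\ Q$ ($\alpha$ an input prefix; $\overline a\langle e\rangle(b)$ outputs $e$ with a fresh bound name $b$; closed processes up to $\alpha$-conversion). Actions $\mu::=\tau\mid a\langle v\rangle(b)\mid \overline a\langle v\rangle(b)\mid h\langle v\rangle\mid \overline h\langle v\rangle\mid\omega$ with the standard transitions: $a(x,b).P\xrightarrow{a\langle v\rangle(b)}P[v/x]$; $\overline a\langle e\rangle(b).P\xrightarrow{\overline a\langle v\rangle(b)}P$ if $e\Downarrow v$; $h(x).P\xrightarrow{h\langle v\rangle}P[v/x]$; $\overline h\langle e\rangle.P\xrightarrow{\overline h\langle v\rangle}P$ if $e\Downarrow v$; $\omega.P\xrightarrow{\omega}0$; $!\alpha.P$ behaves as $\alpha.P|!\alpha.P$;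 restriction $\nu n$ lets through actions not mentioning $n$; sum chooses a summand; $P|Q\xrightarrow{\tau}\nu b(P'|Q')$ if $P\xrightarrow{a\langle v\rangle(b)}P'$, $Q\xrightarrow{\overline a\langle v\rangle(b)}Q'$; $P|Q\xrightarrow{\tau}P'|Q'$ if $P\xrightarrow{h\langle v\rangle}P'$, $Q\xrightarrow{\overline h\langle v\rangle}Q'$; interleaving when bound names are not free in the other component; conditional follows the selected branch. $P\longrightarrow P'$ means $P\xrightarrow{\tau}P'$, $\Longrightarrow$ its reflexive-transitive closure; $P\Downarrow_\omega$ iff $P\Longrightarrow P'\xrightarrow{\omega}$. A visibility function is a finite partial transitive function $\Delta:N_{ho}\cup\{\mathsf{cur}\}\to\mathcal P_{fin}(N_{ho})$ (transitive: $o,a\in\mathrm{dom}\Delta$, $a\in\Delta(o)$ imply $\Delta(a)\subseteq\Delta(o)$). $\Delta,p\mapsto V$ extends; $\Delta\setminus p$ erases $p$ from domain and values; $\Delta_1\cup\Delta_2$: domain union, pointwise union; $(\Delta_1,\Delta_2)\in\mathrm{split}(\Delta)$ iff $\Delta_1\cup\Delta_2=\Delta$ and $\mathsf{cur}\notin\mathrm{dom}\Delta_1\cap\mathrm{dom}\Delta_2$; compatible iff $\mathsf{cur}\notin\mathrm{dom}\Delta\cap\mathrm{dom}\Gamma$. Typing $\Delta\vdash P$: least relation with $\Delta\vdash\overline a\langle e\rangle(b).P$ if $a\in\Delta(\mathsf{cur})$ and $(\Delta\setminus\mathsf{cur}),b\mapsto\Delta(\mathsf{cur})\cup\{b\}\vdash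 P$; $\Delta\vdash a(x,b).P$ if $\mathsf{cur}\notin\mathrm{dom}\Delta$, $a\in\mathrm{dom}\Delta$, $\Delta,\mathsf{cur}\mapsto\Delta(a)\cup\{b\}\vdash P$; $\Delta\vdash\overline h\langle e\rangle.P$ if $\Delta\vdash P$, $\mathsf{cur}\notin\mathrm{dom}\Delta$; $\Delta\vdash h(x).P$ if $\Delta\vdash P$, $\mathsf{cur}\in\mathrm{dom}\Delta$; $\Delta\vdash!\alpha.P$ if $\Delta\vdash\alpha.P$, $\mathsf{cur}\notin\mathrm{dom}\Delta$; $\Delta\vdash\omega.P$; $\Delta\setminus a\vdash\nu aP$ if $\Delta\vdash P$; $\Delta\vdash\nu hP$ if $\Delta\vdash P$; $\Delta\vdash0$ if $\mathsf{cur}\notin\mathrm{dom}\Delta$; sums/conditionals if both branches typed under $\Delta$; $\Delta\vdash P_1|P_2$ if $\Delta_i\vdash P_i$, $(\Delta_1,\Delta_2)\in\mathrm{split}(\Delta)$. Barbed bisimilarity is the largest symmetric relation $\dot\approx$ on processes such that $P\dot\approx Q$ implies: whenever $P\longrightarrow P'$ there is $Q'$ with $Q\Longrightarrow Q'$ and $P'\dot\approx Q'$; and for every $\omega$, $P\Downarrow_\omega$ implies $Q\Downarrow_\omega$. For compatible $\Delta,\Gamma$ and $\Delta$-processes $P,Q$, $P,Q$ are barbed equivalent at $\Gamma$ iff for all closed $R$ with $\Gamma\vdash R$, $P|R\,\dot\approx\,Q|R$. Type-allowed transitions (observer visibility $\Gamma$): if $P\xrightarrow{\overline a\langle v\rangle(b)}P'$,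 $a\in\mathrm{dom}\Gamma$, $\mathsf{cur}\notin\mathrm{dom}\Gamma$: $\Gamma:P\xrightarrow{\overline a\langle v\rangle(b)}(\Gamma,\mathsf{cur}\mapsto\Gamma(a)\cup\{b\}):P'$; if $P\xrightarrow{a\langle v\rangle(b)}P'$, $a\in\Gamma(\mathsf{cur})$: $\Gamma:P\xrightarrow{a\langle v\rangle(b)}((\Gamma\setminus\mathsf{cur}),b\mapsto\Gamma(\mathsf{cur})\cup\{b\}):P'$; $\overline h\langle v\rangle$ allowed (unchanged) if $\mathsf{cur}\in\mathrm{dom}\Gamma$; $h\langle v\rangle$ and $\tau$ allowed (unchanged) if $\mathsf{cur}\notin\mathrm{dom}\Gamma$. $\Gamma:P\xRightarrow{\hat\mu}\Gamma':P'$ means zero or more typed $\tau$-steps (with $\Gamma'=\Gamma$) if $\mu=\tau$, and otherwise typed $\tau$-steps, a $\mu$-step, typed $\tau$-steps. A typed relation is a set of triples $(\Gamma,P,Q)$; it is a typed bisimulation if for each $(\Gamma,P,Q)$ in it, whenever $\Gamma:P\xrightarrow{\mu}\Gamma':P'$ there is $Q'$ with $\Gamma:Q\xRightarrow{\hat\mu}\Gamma':Q'$ and $(\Gamma',P',Q')$ in the relation, and symmetrically. Typed bisimilarity $\approx$ is the largest typed bisimulation; $P\approx^\Delta_\Gamma Q$ iff $(\Gamma,P,Q)\in\approx$ and $\Delta,\Gamma$ compatible. A process is image-finite if, up to $\alpha$-conversion, the set of type-allowed weak transitions emanating from it (and from each of its derivatives) is finite. *)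

theory Defs
  imports Main
begin

text \<open>
  Processes up to \<alpha>-conversion are represented by de Bruijn terms, with three independent
  index spaces: higher-order names, first-order names and value variables. Success names
  are never bound. A free name is an index pointing outside the term, so all processes and
  visibility functions of one statement are read in one common infinite context of names.

  Expressions are terms over a signature of operators \<open>'f\<close> interpreted by \<open>I\<close> on values \<open>'v\<close>;
  both the signature and the interpretation are arbitrary.
\<close>

datatype ('f, 'v) expr =
    Val 'v
  | Var nat
  | App 'f "('f, 'v) expr list"

inductive eval :: "('f \<Rightarrow> 'v list \<Rightarrow> 'v) \<Rightarrow> ('f, 'v) expr \<Rightarrow> 'v \<Rightarrow> bool"
  for I :: "'f \<Rightarrow> 'v list \<Rightarrow> 'v" where
  "eval I (Val v) v"
| "list_all2 (eval I) es vs \<Longrightarrow> eval I (App f es) (I f vs)"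

primrec closed_expr :: "nat \<Rightarrow> ('f, 'v) expr \<Rightarrow> bool" where
  "closed_expr k (Val v) \<longleftrightarrow> True"
| "closed_expr k (Var i) \<longleftrightarrow> i < k"
| "closed_expr k (App f es) \<longleftrightarrow> list_all (\<lambda>b. b) (map (closed_expr k) es)"

primrec subst_expr :: "nat \<Rightarrow> 'v \<Rightarrow> ('f, 'v) expr \<Rightarrow> ('f, 'v) expr" where
  "subst_expr k v (Val w) = Val w"
| "subst_expr k v (Var i) = (if i < k then Var i else if i = k then Val v else Var (i - 1))"
| "subst_expr k v (App f es) = App f (map (subst_expr k v) es)"

text \<open>
  Input prefixes: \<open>HoIn a\<close> is \<open>a(x,b)\<close> and binds in its continuation the variable \<open>x\<close> and the
  higher-order name \<open>b\<close> (both as index 0); \<open>FoIn h\<close> is \<open>h(x)\<close> and binds only \<open>x\<close>.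
\<close>

datatype inprefix = HoIn nat | FoIn nat

text \<open>
  \<open>HoOut a e P\<close> also binds a higher-order name in \<open>P\<close>, whereas \<open>e\<close> is outside that binder.
  \<open>ResHo\<close> and \<open>ResFo\<close> are the restrictions of a higher-order and of a first-order name.
\<close>

datatype ('f, 'v) proc =
    Inp inprefix "('f, 'v) proc"
  | HoOut nat "('f, 'v) expr" "('f, 'v) proc"
  | FoOut nat "('f, 'v) expr" "('f, 'v) proc"
  | Success nat "('f, 'v) proc"
  | Repl inprefix "('f, 'v) proc"
  | Par "('f, 'v) proc" "('f, 'v) proc"
  | ResHo "('f, 'v) proc"
  | ResFo "('f, 'v) proc"
  | Zero
  | Sum "('f, 'v) proc" "('f, 'v) proc"
  | Cond "('f, 'v) expr" "('f, 'v) expr" "('f, 'v) proc" "('f, 'v) proc"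

primrec closed_upto :: "nat \<Rightarrow> ('f, 'v) proc \<Rightarrow> bool" where
  "closed_upto k (Inp \<alpha> P) \<longleftrightarrow> closed_upto (Suc k) P"
| "closed_upto k (HoOut a e P) \<longleftrightarrow> closed_expr k e \<and> closed_upto k P"
| "closed_upto k (FoOut h e P) \<longleftrightarrow> closed_expr k e \<and> closed_upto k P"
| "closed_upto k (Success w P) \<longleftrightarrow> closed_upto k P"
| "closed_upto k (Repl \<alpha> P) \<longleftrightarrow> closed_upto (Suc k) P"
| "closed_upto k (Par P Q) \<longleftrightarrow> closed_upto k P \<and> closed_upto k Q"
| "closed_upto k (ResHo P) \<longleftrightarrow> closed_upto k P"
| "closed_upto k (ResFo P) \<longleftrightarrow> closed_upto k P"
| "closed_upto k Zero \<longleftrightarrow> True"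
| "closed_upto k (Sum P Q) \<longleftrightarrow> closed_upto k P \<and> closed_upto k Q"
| "closed_upto k (Cond e f P Q) \<longleftrightarrow>
     closed_expr k e \<and> closed_expr k f \<and> closed_upto k P \<and> closed_upto k Q"

text \<open>Closed means without free value variables; free names are allowed.\<close>

definition closed_proc :: "('f, 'v) proc \<Rightarrow> bool" where
  "closed_proc P \<longleftrightarrow> closed_upto 0 P"

primrec subst :: "nat \<Rightarrow> 'v \<Rightarrow> ('f, 'v) proc \<Rightarrow> ('f, 'v) proc" where
  "subst k v (Inp \<alpha> P) = Inp \<alpha> (subst (Suc k) v P)"
| "subst k v (HoOut a e P) = HoOut a (subst_expr k v e) (subst k v P)"
| "subst k v (FoOut h e P) = FoOut h (subst_expr k v e) (subst k v P)"
| "subst k v (Success w P) = Success w (subst k v P)"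
| "subst k v (Repl \<alpha> P) = Repl \<alpha> (subst (Suc k) v P)"
| "subst k v (Par P Q) = Par (subst k v P) (subst k v Q)"
| "subst k v (ResHo P) = ResHo (subst k v P)"
| "subst k v (ResFo P) = ResFo (subst k v P)"
| "subst k v Zero = Zero"
| "subst k v (Sum P Q) = Sum (subst k v P) (subst k v Q)"
| "subst k v (Cond e f P Q) =
     Cond (subst_expr k v e) (subst_expr k v f) (subst k v P) (subst k v Q)"

text \<open>Renaming of the free higher-order names.\<close>

definition lift_ren :: "(nat \<Rightarrow> nat) \<Rightarrow> nat \<Rightarrow> nat" where
  "lift_ren r n = (case n of 0 \<Rightarrow> 0 | Suc m \<Rightarrow> Suc (r m))"

primrec ren_prefix :: "(nat \<Rightarrow> nat) \<Rightarrow> inprefix \<Rightarrow> inprefix" where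
  "ren_prefix r (HoIn a) = HoIn (r a)"
| "ren_prefix r (FoIn h) = FoIn h"

primrec prefix_ren :: "inprefix \<Rightarrow> (nat \<Rightarrow> nat) \<Rightarrow> nat \<Rightarrow> nat" where
  "prefix_ren (HoIn a) r = lift_ren r"
| "prefix_ren (FoIn h) r = r"

primrec ren :: "(nat \<Rightarrow> nat) \<Rightarrow> ('f, 'v) proc \<Rightarrow> ('f, 'v) proc" where
  "ren r (Inp \<alpha> P) = Inp (ren_prefix r \<alpha>) (ren (prefix_ren \<alpha> r) P)"
| "ren r (HoOut a e P) = HoOut (r a) e (ren (lift_ren r) P)"
| "ren r (FoOut h e P) = FoOut h e (ren r P)"
| "ren r (Success w P) = Success w (ren r P)"
| "ren r (Repl \<alpha> P) = Repl (ren_prefix r \<alpha>) (ren (prefix_ren \<alpha> r) P)"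
| "ren r (Par P Q) = Par (ren r P) (ren r Q)"
| "ren r (ResHo P) = ResHo (ren (lift_ren r) P)"
| "ren r (ResFo P) = ResFo (ren r P)"
| "ren r Zero = Zero"
| "ren r (Sum P Q) = Sum (ren r P) (ren r Q)"
| "ren r (Cond e f P Q) = Cond e f (ren r P) (ren r Q)"

definition shift :: "('f, 'v) proc \<Rightarrow> ('f, 'v) proc" where
  "shift P = ren Suc P"

definition swap01 :: "('f, 'v) proc \<Rightarrow> ('f, 'v) proc" where
  "swap01 P = ren (id(0 := 1, 1 := 0)) P"

text \<open>
  \<open>AHoIn a v\<close> is the action \<open>a\<langle>v\<rangle>(b)\<close> and \<open>AHoOut a v\<close> its output counterpart. The fresh name \<open>b\<close>
  is index 0 in the target of the transition, where all other higher-order names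
  are shifted by one; it is thereby distinct from every other name in use.
\<close>

datatype 'v action =
    Tau
  | AHoIn nat 'v
  | AHoOut nat 'v
  | AFoIn nat 'v
  | AFoOut nat 'v
  | ASuccess nat

primrec binds :: "'v action \<Rightarrow> bool" where
  "binds Tau \<longleftrightarrow> False"
| "binds (AHoIn a v) \<longleftrightarrow> True"
| "binds (AHoOut a v) \<longleftrightarrow> True"
| "binds (AFoIn h v) \<longleftrightarrow> False"
| "binds (AFoOut h v) \<longleftrightarrow> False"
| "binds (ASuccess w) \<longleftrightarrow> False"

primrec lift_ho :: "'v action \<Rightarrow> 'v action" where
  "lift_ho Tau = Tau"
| "lift_ho (AHoIn a v) = AHoIn (Suc a) v"
| "lift_ho (AHoOut a v) = AHoOut (Suc a) v"
| "lift_ho (AFoIn h v) = AFoIn h v"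
| "lift_ho (AFoOut h v) = AFoOut h v"
| "lift_ho (ASuccess w) = ASuccess w"

primrec lift_fo :: "'v action \<Rightarrow> 'v action" where
  "lift_fo Tau = Tau"
| "lift_fo (AHoIn a v) = AHoIn a v"
| "lift_fo (AHoOut a v) = AHoOut a v"
| "lift_fo (AFoIn h v) = AFoIn (Suc h) v"
| "lift_fo (AFoOut h v) = AFoOut (Suc h) v"
| "lift_fo (ASuccess w) = ASuccess w"

text \<open>A process standing beside the one that performs \<open>\<mu>\<close>.\<close>

definition beside :: "'v action \<Rightarrow> ('f, 'v) proc \<Rightarrow> ('f, 'v) proc" where
  "beside \<mu> Q = (if binds \<mu> then shift Q else Q)"

text \<open>
  In the restriction rules the premise's label has the form \<open>lift_ho \<mu>\<close> (\<open>lift_fo \<mu>\<close>), i.e.\ does not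
  mention the restricted index 0. If \<open>\<mu>\<close> binds, its fresh name and the restricted name
  are exchanged, since the restriction stays the innermost binder.
  The rule for replication is the step of the left component of \<open>\<alpha>.P | !\<alpha>.P\<close>.
\<close>

inductive step :: "('f \<Rightarrow> 'v list \<Rightarrow> 'v) \<Rightarrow> ('f, 'v) proc \<Rightarrow> 'v action \<Rightarrow> ('f, 'v) proc \<Rightarrow> bool"
  for I :: "'f \<Rightarrow> 'v list \<Rightarrow> 'v" where
  HoIn: "step I (Inp (HoIn a) P) (AHoIn a v) (subst 0 v P)"
| HoOut: "eval I e v \<Longrightarrow> step I (HoOut a e P) (AHoOut a v) P"
| FoIn: "step I (Inp (FoIn h) P) (AFoIn h v) (subst 0 v P)"
| FoOut: "eval I e v \<Longrightarrow> step I (FoOut h e P) (AFoOut h v) P"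
| Success: "step I (Success w P) (ASuccess w) Zero"
| Repl: "step I (Inp \<alpha> P) \<mu> P' \<Longrightarrow> step I (Repl \<alpha> P) \<mu> (Par P' (beside \<mu> (Repl \<alpha> P)))"
| ResHo: "step I P (lift_ho \<mu>) P' \<Longrightarrow>
    step I (ResHo P) \<mu> (ResHo (if binds \<mu> then swap01 P' else P'))"
| ResFo: "step I P (lift_fo \<mu>) P' \<Longrightarrow> step I (ResFo P) \<mu> (ResFo P')"
| SumL: "step I P \<mu> P' \<Longrightarrow> step I (Sum P Q) \<mu> P'"
| SumR: "step I Q \<mu> Q' \<Longrightarrow> step I (Sum P Q) \<mu> Q'"
| ParL: "step I P \<mu> P' \<Longrightarrow> step I (Par P Q) \<mu> (Par P' (beside \<mu> Q))"
| ParR: "step I Q \<mu> Q' \<Longrightarrow> step I (Par P Q) \<mu> (Par (beside \<mu> P) Q')"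
| HoComL: "\<lbrakk>step I P (AHoIn a v) P'; step I Q (AHoOut a v) Q'\<rbrakk> \<Longrightarrow>
    step I (Par P Q) Tau (ResHo (Par P' Q'))"
| HoComR: "\<lbrakk>step I P (AHoOut a v) P'; step I Q (AHoIn a v) Q'\<rbrakk> \<Longrightarrow>
    step I (Par P Q) Tau (ResHo (Par P' Q'))"
| FoComL: "\<lbrakk>step I P (AFoIn h v) P'; step I Q (AFoOut h v) Q'\<rbrakk> \<Longrightarrow>
    step I (Par P Q) Tau (Par P' Q')"
| FoComR: "\<lbrakk>step I P (AFoOut h v) P'; step I Q (AFoIn h v) Q'\<rbrakk> \<Longrightarrow>
    step I (Par P Q) Tau (Par P' Q')"
| CondT: "\<lbrakk>eval I e v; eval I f v; step I P \<mu> P'\<rbrakk> \<Longrightarrow> step I (Cond e f P Q) \<mu> P'"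
| CondF: "\<lbrakk>eval I e v; eval I f w; v \<noteq> w; step I Q \<mu> Q'\<rbrakk> \<Longrightarrow> step I (Cond e f P Q) \<mu> Q'"

definition red :: "('f \<Rightarrow> 'v list \<Rightarrow> 'v) \<Rightarrow> ('f, 'v) proc \<Rightarrow> ('f, 'v) proc \<Rightarrow> bool" where
  "red I P P' \<longleftrightarrow> step I P Tau P'"

definition weak_barb :: "('f \<Rightarrow> 'v list \<Rightarrow> 'v) \<Rightarrow> ('f, 'v) proc \<Rightarrow> nat \<Rightarrow> bool" where
  "weak_barb I P w \<longleftrightarrow> (\<exists>P' P''. (red I)\<^sup>*\<^sup>* P P' \<and> step I P' (ASuccess w) P'')"

subsection \<open>Visibility functions and typing\<close>

datatype point = Cur | Nm nat

type_synonym vis = "point \<Rightarrow> nat set option"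

definition visibility :: "vis \<Rightarrow> bool" where
  "visibility \<Delta> \<longleftrightarrow> finite (dom \<Delta>) \<and> (\<forall>V \<in> ran \<Delta>. finite V) \<and>
     (\<forall>p a V W. \<Delta> p = Some V \<longrightarrow> \<Delta> (Nm a) = Some W \<longrightarrow> a \<in> V \<longrightarrow> W \<subseteq> V)"

definition erase :: "point \<Rightarrow> vis \<Rightarrow> vis" where
  "erase p \<Delta> = (\<lambda>q. if q = p then None else map_option (\<lambda>V. {a \<in> V. Nm a \<noteq> p}) (\<Delta> q))"

definition union_vis :: "vis \<Rightarrow> vis \<Rightarrow> vis" where
  "union_vis \<Delta>1 \<Delta>2 = (\<lambda>p. case (\<Delta>1 p, \<Delta>2 p) of
      (None, y) \<Rightarrow> y
    | (Some V, None) \<Rightarrow> Some V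
    | (Some V, Some W) \<Rightarrow> Some (V \<union> W))"

definition compatible :: "vis \<Rightarrow> vis \<Rightarrow> bool" where
  "compatible \<Delta> \<Gamma> \<longleftrightarrow> Cur \<notin> dom \<Delta> \<inter> dom \<Gamma>"

definition split :: "vis \<Rightarrow> (vis \<times> vis) set" where
  "split \<Delta> = {(\<Delta>1, \<Delta>2). visibility \<Delta>1 \<and> visibility \<Delta>2 \<and> union_vis \<Delta>1 \<Delta>2 = \<Delta> \<and>
                Cur \<notin> dom \<Delta>1 \<inter> dom \<Delta>2}"

text \<open>The visibility function \<open>\<Delta>\<close> read under one more binder; name 0 does not occur in the result.\<close>

definition shift_vis :: "vis \<Rightarrow> vis" where
  "shift_vis \<Delta> = (\<lambda>p. case p of
      Cur \<Rightarrow> map_option (image Suc) (\<Delta> Cur)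
    | Nm 0 \<Rightarrow> None
    | Nm (Suc a) \<Rightarrow> map_option (image Suc) (\<Delta> (Nm a)))"

text \<open>
  For \<open>b\<close> the fresh name 0: \<open>give_cur V \<Delta>\<close> is \<open>(\<Delta>, cur \<mapsto> V \<union> {b})\<close> and
  \<open>drop_cur V \<Delta>\<close> is \<open>((\<Delta> \ cur), b \<mapsto> V \<union> {b})\<close>. Both preserve \<open>visibility\<close> when used as below.
\<close>

definition give_cur :: "nat set \<Rightarrow> vis \<Rightarrow> vis" where
  "give_cur V \<Delta> = (shift_vis \<Delta>)(Cur \<mapsto> Suc ` V \<union> {0})"

definition drop_cur :: "nat set \<Rightarrow> vis \<Rightarrow> vis" where
  "drop_cur V \<Delta> = (shift_vis (erase Cur \<Delta>))(Nm 0 \<mapsto> Suc ` V \<union> {0})"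

text \<open>
  Typing contexts are visibility functions: this is required explicitly where a premise's context is
  not determined by the conclusion (in \<open>split\<close> and in \<open>T_ResHo\<close>). In \<open>T_ResHo\<close>, \<open>\<Delta>\<close> is \<open>\<Delta>' \ a\<close> read outside
  the restriction of \<open>a\<close>.
\<close>

inductive typing :: "vis \<Rightarrow> ('f, 'v) proc \<Rightarrow> bool" (infix "\<turnstile>" 50) where
  T_HoOut: "\<lbrakk>\<Delta> Cur = Some V; a \<in> V; drop_cur V \<Delta> \<turnstile> P\<rbrakk> \<Longrightarrow> \<Delta> \<turnstile> HoOut a e P"
| T_HoIn: "\<lbrakk>Cur \<notin> dom \<Delta>; \<Delta> (Nm a) = Some V; give_cur V \<Delta> \<turnstile> P\<rbrakk> \<Longrightarrow> \<Delta> \<turnstile> Inp (HoIn a) P"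
| T_FoOut: "\<lbrakk>\<Delta> \<turnstile> P; Cur \<notin> dom \<Delta>\<rbrakk> \<Longrightarrow> \<Delta> \<turnstile> FoOut h e P"
| T_FoIn: "\<lbrakk>\<Delta> \<turnstile> P; Cur \<in> dom \<Delta>\<rbrakk> \<Longrightarrow> \<Delta> \<turnstile> Inp (FoIn h) P"
| T_Repl: "\<lbrakk>\<Delta> \<turnstile> Inp \<alpha> P; Cur \<notin> dom \<Delta>\<rbrakk> \<Longrightarrow> \<Delta> \<turnstile> Repl \<alpha> P"
| T_Success: "\<Delta> \<turnstile> Success w P"
| T_ResHo: "\<lbrakk>visibility \<Delta>'; erase (Nm 0) \<Delta>' = shift_vis \<Delta>; \<Delta>' \<turnstile> P\<rbrakk> \<Longrightarrow> \<Delta> \<turnstile> ResHo P"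
| T_ResFo: "\<Delta> \<turnstile> P \<Longrightarrow> \<Delta> \<turnstile> ResFo P"
| T_Zero: "Cur \<notin> dom \<Delta> \<Longrightarrow> \<Delta> \<turnstile> Zero"
| T_Sum: "\<lbrakk>\<Delta> \<turnstile> P; \<Delta> \<turnstile> Q\<rbrakk> \<Longrightarrow> \<Delta> \<turnstile> Sum P Q"
| T_Cond: "\<lbrakk>\<Delta> \<turnstile> P; \<Delta> \<turnstile> Q\<rbrakk> \<Longrightarrow> \<Delta> \<turnstile> Cond e f P Q"
| T_Par: "\<lbrakk>(\<Delta>1, \<Delta>2) \<in> split \<Delta>; \<Delta>1 \<turnstile> P1; \<Delta>2 \<turnstile> P2\<rbrakk> \<Longrightarrow> \<Delta> \<turnstile> Par P1 P2"

subsection \<open>Barbed equivalence\<close>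

definition barbed_bisimulation ::
  "('f \<Rightarrow> 'v list \<Rightarrow> 'v) \<Rightarrow> (('f, 'v) proc \<times> ('f, 'v) proc) set \<Rightarrow> bool" where
  "barbed_bisimulation I S \<longleftrightarrow> sym S \<and>
     (\<forall>(P, Q) \<in> S.
        (\<forall>P'. red I P P' \<longrightarrow> (\<exists>Q'. (red I)\<^sup>*\<^sup>* Q Q' \<and> (P', Q') \<in> S)) \<and>
        (\<forall>w. weak_barb I P w \<longrightarrow> weak_barb I Q w))"

definition barbed_bisimilarity ::
  "('f \<Rightarrow> 'v list \<Rightarrow> 'v) \<Rightarrow> (('f, 'v) proc \<times> ('f, 'v) proc) set" where
  "barbed_bisimilarity I = \<Union> {S. barbed_bisimulation I S}"

definition barbed_equivalent ::
  "('f \<Rightarrow> 'v list \<Rightarrow> 'v) \<Rightarrow> vis \<Rightarrow> ('f, 'v) proc \<Rightarrow> ('f, 'v) proc \<Rightarrow> bool" where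
  "barbed_equivalent I \<Gamma> P Q \<longleftrightarrow>
     (\<forall>R. closed_proc R \<longrightarrow> \<Gamma> \<turnstile> R \<longrightarrow> (Par P R, Par Q R) \<in> barbed_bisimilarity I)"

subsection \<open>Typed bisimilarity\<close>

inductive tstep ::
  "('f \<Rightarrow> 'v list \<Rightarrow> 'v) \<Rightarrow> vis \<Rightarrow> ('f, 'v) proc \<Rightarrow> 'v action \<Rightarrow> vis \<Rightarrow> ('f, 'v) proc \<Rightarrow> bool"
  for I :: "'f \<Rightarrow> 'v list \<Rightarrow> 'v" where
  "\<lbrakk>step I P (AHoOut a v) P'; \<Gamma> (Nm a) = Some V; Cur \<notin> dom \<Gamma>\<rbrakk> \<Longrightarrow>
    tstep I \<Gamma> P (AHoOut a v) (give_cur V \<Gamma>) P'"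
| "\<lbrakk>step I P (AHoIn a v) P'; \<Gamma> Cur = Some V; a \<in> V\<rbrakk> \<Longrightarrow>
    tstep I \<Gamma> P (AHoIn a v) (drop_cur V \<Gamma>) P'"
| "\<lbrakk>step I P (AFoOut h v) P'; Cur \<in> dom \<Gamma>\<rbrakk> \<Longrightarrow> tstep I \<Gamma> P (AFoOut h v) \<Gamma> P'"
| "\<lbrakk>step I P (AFoIn h v) P'; Cur \<notin> dom \<Gamma>\<rbrakk> \<Longrightarrow> tstep I \<Gamma> P (AFoIn h v) \<Gamma> P'"
| "\<lbrakk>step I P Tau P'; Cur \<notin> dom \<Gamma>\<rbrakk> \<Longrightarrow> tstep I \<Gamma> P Tau \<Gamma> P'"

definition ttaus ::
  "('f \<Rightarrow> 'v list \<Rightarrow> 'v) \<Rightarrow> vis \<Rightarrow> ('f, 'v) proc \<Rightarrow> ('f, 'v) proc \<Rightarrow> bool" where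
  "ttaus I \<Gamma> = (\<lambda>P P'. tstep I \<Gamma> P Tau \<Gamma> P')\<^sup>*\<^sup>*"

definition wtstep ::
  "('f \<Rightarrow> 'v list \<Rightarrow> 'v) \<Rightarrow> vis \<Rightarrow> ('f, 'v) proc \<Rightarrow> 'v action \<Rightarrow> vis \<Rightarrow> ('f, 'v) proc \<Rightarrow> bool" where
  "wtstep I \<Gamma> P \<mu> \<Gamma>' P' \<longleftrightarrow>
     (if \<mu> = Tau then \<Gamma>' = \<Gamma> \<and> ttaus I \<Gamma> P P'
      else \<exists>P1 P2. ttaus I \<Gamma> P P1 \<and> tstep I \<Gamma> P1 \<mu> \<Gamma>' P2 \<and> ttaus I \<Gamma>' P2 P')"

definition typed_bisimulation ::
  "('f \<Rightarrow> 'v list \<Rightarrow> 'v) \<Rightarrow> (vis \<times> ('f, 'v) proc \<times> ('f, 'v) proc) set \<Rightarrow> bool" where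
  "typed_bisimulation I S \<longleftrightarrow>
     (\<forall>(\<Gamma>, P, Q) \<in> S.
        (\<forall>\<mu> \<Gamma>' P'. tstep I \<Gamma> P \<mu> \<Gamma>' P' \<longrightarrow> (\<exists>Q'. wtstep I \<Gamma> Q \<mu> \<Gamma>' Q' \<and> (\<Gamma>', P', Q') \<in> S)) \<and>
        (\<forall>\<mu> \<Gamma>' Q'. tstep I \<Gamma> Q \<mu> \<Gamma>' Q' \<longrightarrow> (\<exists>P'. wtstep I \<Gamma> P \<mu> \<Gamma>' P' \<and> (\<Gamma>', P', Q') \<in> S)))"

definition typed_bisimilarity ::
  "('f \<Rightarrow> 'v list \<Rightarrow> 'v) \<Rightarrow> (vis \<times> ('f, 'v) proc \<times> ('f, 'v) proc) set" where
  "typed_bisimilarity I = \<Union> {S. typed_bisimulation I S}"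

definition typed_bisimilar ::
  "('f \<Rightarrow> 'v list \<Rightarrow> 'v) \<Rightarrow> vis \<Rightarrow> vis \<Rightarrow> ('f, 'v) proc \<Rightarrow> ('f, 'v) proc \<Rightarrow> bool" where
  "typed_bisimilar I \<Delta> \<Gamma> P Q \<longleftrightarrow> (\<Gamma>, P, Q) \<in> typed_bisimilarity I \<and> compatible \<Delta> \<Gamma>"

text \<open>
  Image-finiteness is understood per action, as usual: inputs are early, so over an infinite
  set of values any input gives infinitely many transitions with different labels.
  Transitions up to \<alpha>-conversion are here just transitions.
\<close>

definition derivative ::
  "('f \<Rightarrow> 'v list \<Rightarrow> 'v) \<Rightarrow> vis \<times> ('f, 'v) proc \<Rightarrow> vis \<times> ('f, 'v) proc \<Rightarrow> bool" where
  "derivative I = (\<lambda>(\<Gamma>, P) (\<Gamma>', P'). \<exists>\<mu>. tstep I \<Gamma> P \<mu> \<Gamma>' P')\<^sup>*\<^sup>*"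

definition image_finite ::
  "('f \<Rightarrow> 'v list \<Rightarrow> 'v) \<Rightarrow> vis \<Rightarrow> ('f, 'v) proc \<Rightarrow> bool" where
  "image_finite I \<Gamma> P \<longleftrightarrow>
     (\<forall>\<Gamma>' P'. derivative I (\<Gamma>, P) (\<Gamma>', P') \<longrightarrow>
        (\<forall>\<mu>. finite {(\<Gamma>'', P''). wtstep I \<Gamma>' P' \<mu> \<Gamma>'' P''}))"

end

theory Submission
  imports Defs
begin

text \<open>
  Call \<open>P\<close> and \<open>Q\<close> apart at \<open>\<Gamma>\<close> if one of them has a type-allowed step whose every weak answer by the
  other leads to apart processes, this relation being the least one; its complement is a typed
  bisimulation. By induction on apartness we build an observer \<open>R\<close> with \<open>\<Gamma> \<turnstile> R\<close> telling \<open>P\<close> and \<open>Q\<close>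
  apart; image-finiteness leaves finitely many answers, whose observers are put into one sum.
  An observer cannot choose between its summands by internal steps, as it may not own the thread.
  Instead all summands use disjoint sets of fresh success names, so that each summand still
  distinguishes when it is placed in an arbitrary larger sum: the barbs reveal whether the observer
  has moved and into which summand. Typing of \<open>P\<close> and \<open>Q\<close> matters only for the fact that
  a process not owning the thread has no internal step, so the answers found are type-allowed.
\<close>

section \<open>Success names\<close>

text \<open>
  A conditional between two values counts only the selected branch, so that the tests
  \<open>if v = w then R else \<omega>\<close> of the observers below lose the names of the other branch once \<open>v\<close> is received.
\<close>

primrec succ_names :: "('f, 'v) proc \<Rightarrow> nat set" where
  "succ_names (Inp \<alpha> P) = succ_names P"
| "succ_names (HoOut a e P) = succ_names P"
| "succ_names (FoOut h e P) = succ_names P"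
| "succ_names (Success w P) = {w}"
| "succ_names (Repl \<alpha> P) = succ_names P"
| "succ_names (Par P Q) = succ_names P \<union> succ_names Q"
| "succ_names (ResHo P) = succ_names P"
| "succ_names (ResFo P) = succ_names P"
| "succ_names Zero = {}"
| "succ_names (Sum P Q) = succ_names P \<union> succ_names Q"
| "succ_names (Cond e f P Q) =
     (if \<exists>v w. e = Val v \<and> f = Val w then (if e = f then succ_names P else succ_names Q)
      else succ_names P \<union> succ_names Q)"

lemma finite_succ_names: "finite (succ_names P)"
  by (induction P) auto

lemma succ_names_ren [simp]: "succ_names (ren r P) = succ_names P"
  by (induction P arbitrary: r) auto

lemma succ_names_shift [simp]: "succ_names (shift P) = succ_names P"
  by (simp add: shift_def)

lemma succ_names_swap01 [simp]: "succ_names (swap01 P) = succ_names P"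
  by (simp add: swap01_def)

lemma succ_names_beside [simp]: "succ_names (beside \<mu> P) = succ_names P"
  by (simp add: beside_def)

text \<open>Only an inclusion holds: substitution may turn both sides of a conditional into values,
  and then the branch not selected stops being counted.\<close>

lemma succ_names_subst: "succ_names (subst k v P) \<subseteq> succ_names P"
proof (induction P arbitrary: k)
  case (Cond e f P Q)
  show ?case
  proof (cases "\<exists>v w. e = Val v \<and> f = Val w")
    case True
    then show ?thesis using Cond by auto
  next
    case False
    then have "succ_names (Cond e f P Q) = succ_names P \<union> succ_names Q"
      by auto
    moreover have "succ_names (subst k v (Cond e f P Q)) \<subseteq>
        succ_names (subst k v P) \<union> succ_names (subst k v Q)"
      by simp
    ultimately show ?thesis
      using Cond by blast
  qed
qed (fastforce)+

inductive_cases eval_ValE: "eval I (Val v) w"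

lemma eval_Val [simp]: "eval I (Val v) w \<longleftrightarrow> v = w"
  by (auto intro: eval.intros elim: eval_ValE)

text \<open>Success names are never received or renamed, so a step can only discard some; in a
  conditional between values the branch that runs is the branch counted.\<close>

lemma step_succ_names: "step I P \<mu> P' \<Longrightarrow> succ_names P' \<subseteq> succ_names P"
proof (induction rule: step.induct)
  case (HoIn a P v)
  then show ?case using succ_names_subst by simp
next
  case (FoIn h P v)
  then show ?case using succ_names_subst by simp
qed (auto split: if_splits)

lemma step_Success_names:
  assumes "step I P (ASuccess w) P'" shows "w \<in> succ_names P"
proof -
  have "w \<in> succ_names P" if "step I P \<mu> P'" "\<mu> = ASuccess w" for \<mu>
    using that
  proof (induction rule: step.induct)
    case (ResHo P \<mu> P')
    then show ?case by simp
  next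
    case (ResFo P \<mu> P')
    then show ?case by simp
  next
    case (Repl \<alpha> P \<mu> P')
    then show ?case by simp
  qed auto
  with assms show ?thesis by blast
qed

lemma reds_succ_names: "(red I)\<^sup>*\<^sup>* P P' \<Longrightarrow> succ_names P' \<subseteq> succ_names P"
  by (induction rule: rtranclp_induct) (auto simp: red_def dest: step_succ_names)

lemma weak_barb_succ_names: "weak_barb I P w \<Longrightarrow> w \<in> succ_names P"
  unfolding weak_barb_def using reds_succ_names step_Success_names by blast

lemma weak_barb_step: "step I P (ASuccess w) P' \<Longrightarrow> weak_barb I P w"
  unfolding weak_barb_def by blast

section \<open>Reductions and barbs of composites\<close>

text \<open>The action with which a partner synchronises; the values at \<open>Tau\<close> and
  \<open>ASuccess\<close> are conventional and keep \<open>dual\<close> an involution.\<close>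

primrec dual :: "'v action \<Rightarrow> 'v action" where
  "dual Tau = Tau"
| "dual (AHoIn a v) = AHoOut a v"
| "dual (AHoOut a v) = AHoIn a v"
| "dual (AFoIn h v) = AFoOut h v"
| "dual (AFoOut h v) = AFoIn h v"
| "dual (ASuccess w) = ASuccess w"

primrec is_comm :: "'v action \<Rightarrow> bool" where
  "is_comm Tau \<longleftrightarrow> False"
| "is_comm (AHoIn a v) \<longleftrightarrow> True"
| "is_comm (AHoOut a v) \<longleftrightarrow> True"
| "is_comm (AFoIn h v) \<longleftrightarrow> True"
| "is_comm (AFoOut h v) \<longleftrightarrow> True"
| "is_comm (ASuccess w) \<longleftrightarrow> False"

text \<open>After a higher-order communication the partners share the fresh name 0, which gets
  restricted; a first-order one binds nothing. This gives the four communication rules one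
  form.\<close>

definition close :: "'v action \<Rightarrow> ('f, 'v) proc \<Rightarrow> ('f, 'v) proc" where
  "close \<mu> P = (if binds \<mu> then ResHo P else P)"

lemma succ_names_close [simp]: "succ_names (close \<mu> P) = succ_names P"
  by (simp add: close_def)

lemma dual_dual [simp]: "dual (dual \<mu>) = \<mu>"
  by (cases \<mu>) auto

inductive_cases step_ResHoE: "step I (ResHo P) \<mu> X"
inductive_cases step_SumE: "step I (Sum P Q) \<mu> X"
inductive_cases step_CondE: "step I (Cond e f P Q) \<mu> X"
inductive_cases step_SuccessE: "step I (Success w P) \<mu> X"
inductive_cases step_ZeroE: "step I Zero \<mu> X"
inductive_cases step_HoInE: "step I (Inp (HoIn a) P) \<mu> X"
inductive_cases step_FoInE: "step I (Inp (FoIn h) P) \<mu> X"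
inductive_cases step_HoOutE: "step I (HoOut a e P) \<mu> X"
inductive_cases step_FoOutE: "step I (FoOut h e P) \<mu> X"

lemma step_Sum_iff: "step I (Sum P Q) \<mu> X \<longleftrightarrow> step I P \<mu> X \<or> step I Q \<mu> X"
  by (auto intro: step.intros elim: step_SumE)

lemma step_Success_iff: "step I (Success w P) \<mu> X \<longleftrightarrow> \<mu> = ASuccess w \<and> X = Zero"
  by (auto intro: step.intros elim: step_SuccessE)

lemma step_Zero_iff: "\<not> step I Zero \<mu> X"
  by (auto elim: step_ZeroE)

lemma step_Cond_Val_iff:
  "step I (Cond (Val v) (Val w) P Q) \<mu> X \<longleftrightarrow> (if v = w then step I P \<mu> X else step I Q \<mu> X)"
  by (auto intro: step.intros elim: step_CondE)

lemma red_Par_cases: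
  assumes "red I (Par Q S) X"
  obtains (left) Q' where "red I Q Q'" "X = Par Q' S"
  | (right) S' where "red I S S'" "X = Par Q S'"
  | (comm) \<mu> Q' S' where "is_comm \<mu>" "step I Q \<mu> Q'" "step I S (dual \<mu>) S'"
      "X = close \<mu> (Par Q' S')"
proof -
  have "step I (Par Q S) Tau X"
    using assms by (simp add: red_def)
  then show thesis
  proof (cases rule: step.cases)
    case (HoComL a v P' Q')
    then show ?thesis using comm[of "AHoIn a v" P' Q'] by (simp add: close_def)
  next
    case (HoComR a v P' Q')
    then show ?thesis using comm[of "AHoOut a v" P' Q'] by (simp add: close_def)
  next
    case (FoComL h v P' Q')
    then show ?thesis using comm[of "AFoIn h v" P' Q'] by (simp add: close_def)
  next
    case (FoComR h v P' Q')
    then show ?thesis using comm[of "AFoOut h v" P' Q'] by (simp add: close_def)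
  qed (use left right in \<open>auto simp: beside_def red_def\<close>)
qed

lemma red_Par_comm:
  assumes "is_comm \<mu>" "step I Q \<mu> Q'" "step I S (dual \<mu>) S'"
  shows "red I (Par Q S) (close \<mu> (Par Q' S'))"
  using assms by (cases \<mu>) (auto simp: red_def close_def intro: step.intros)

lemma red_Par_left: "red I Q Q' \<Longrightarrow> red I (Par Q S) (Par Q' S)"
  using ParL[of I Q Tau Q' S] by (simp add: red_def beside_def)

lemma step_Par_Success_right: "step I S (ASuccess w) S' \<Longrightarrow> step I (Par Q S) (ASuccess w) (Par Q S')"
  using ParR[of I S "ASuccess w" S' Q] by (simp add: beside_def)

lemma red_ResHo_iff: "red I (ResHo P) X \<longleftrightarrow> (\<exists>P'. X = ResHo P' \<and> red I P P')"
  using ResHo[of I P Tau] by (auto simp: red_def elim: step_ResHoE)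

lemma reds_ResHo_iff: "(red I)\<^sup>*\<^sup>* (ResHo P) X \<longleftrightarrow> (\<exists>P'. X = ResHo P' \<and> (red I)\<^sup>*\<^sup>* P P')"
proof
  assume "(red I)\<^sup>*\<^sup>* (ResHo P) X"
  then show "\<exists>P'. X = ResHo P' \<and> (red I)\<^sup>*\<^sup>* P P'"
    by (induction rule: rtranclp_induct) (auto simp: red_ResHo_iff intro: rtranclp.rtrancl_into_rtrancl)
next
  assume "\<exists>P'. X = ResHo P' \<and> (red I)\<^sup>*\<^sup>* P P'"
  then obtain P' where P': "(red I)\<^sup>*\<^sup>* P P'" and X: "X = ResHo P'" by blast
  from P' have "(red I)\<^sup>*\<^sup>* (ResHo P) (ResHo P')"
    by (induction rule: rtranclp_induct) (auto simp: red_ResHo_iff intro: rtranclp.rtrancl_into_rtrancl)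
  with X show "(red I)\<^sup>*\<^sup>* (ResHo P) X" by simp
qed

lemma weak_barb_ResHo_iff: "weak_barb I (ResHo P) w \<longleftrightarrow> weak_barb I P w"
proof -
  have "(\<exists>P''. step I (ResHo P) (ASuccess w) P'') \<longleftrightarrow> (\<exists>P''. step I P (ASuccess w) P'')" for P
    using ResHo[of I P "ASuccess w"] by (auto elim!: step_ResHoE)
  then show ?thesis
    unfolding weak_barb_def reds_ResHo_iff by blast
qed

lemma reds_close:
  assumes "(red I)\<^sup>*\<^sup>* (close \<mu> P) X"
  obtains P' where "X = close \<mu> P'" "(red I)\<^sup>*\<^sup>* P P'"
  using assms unfolding close_def by (auto simp: reds_ResHo_iff split: if_splits)

lemma weak_barb_close_iff: "weak_barb I (close \<mu> P) w \<longleftrightarrow> weak_barb I P w"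
  by (simp add: close_def weak_barb_ResHo_iff)

section \<open>Barbed bisimilarity\<close>

lemma barbed_bisimilarity_sym:
  "(P, Q) \<in> barbed_bisimilarity I \<Longrightarrow> (Q, P) \<in> barbed_bisimilarity I"
  by (auto simp: barbed_bisimilarity_def barbed_bisimulation_def dest: symD)

lemma barbed_bisimilarity_red:
  assumes "(P, Q) \<in> barbed_bisimilarity I" "red I P P'"
  obtains Q' where "(red I)\<^sup>*\<^sup>* Q Q'" "(P', Q') \<in> barbed_bisimilarity I"
proof -
  obtain S where S: "barbed_bisimulation I S" "(P, Q) \<in> S"
    using assms(1) by (auto simp: barbed_bisimilarity_def)
  then obtain Q' where "(red I)\<^sup>*\<^sup>* Q Q'" "(P', Q') \<in> S"
    using assms(2) unfolding barbed_bisimulation_def by blast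
  then show ?thesis
    using S(1) that unfolding barbed_bisimilarity_def by blast
qed

lemma barbed_bisimilarity_weak_barb:
  assumes "(P, Q) \<in> barbed_bisimilarity I" "weak_barb I P w"
  shows "weak_barb I Q w"
proof -
  obtain S where S: "barbed_bisimulation I S" "(P, Q) \<in> S"
    using assms(1) by (auto simp: barbed_bisimilarity_def)
  then show ?thesis
    using assms(2) unfolding barbed_bisimulation_def by blast
qed

text \<open>Strips the restriction that a communication with the observer leaves behind. It works
  because restriction neither adds nor removes reductions or barbs.\<close>

lemma barbed_bisimilarity_ResHo:
  assumes "(ResHo P, ResHo Q) \<in> barbed_bisimilarity I"
  shows "(P, Q) \<in> barbed_bisimilarity I"
proof -
  let ?S = "{(P, Q). (ResHo P, ResHo Q) \<in> barbed_bisimilarity I}"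
  have "\<exists>Q'. (red I)\<^sup>*\<^sup>* Q Q' \<and> (P', Q') \<in> ?S" if S: "(P, Q) \<in> ?S" and red: "red I P P'" for P Q P'
  proof -
    have "red I (ResHo P) (ResHo P')"
      using red by (simp add: red_ResHo_iff)
    then obtain X where "(red I)\<^sup>*\<^sup>* (ResHo Q) X" "(ResHo P', X) \<in> barbed_bisimilarity I"
      using S barbed_bisimilarity_red by blast
    then show ?thesis
      by (auto simp: reds_ResHo_iff)
  qed
  moreover have "weak_barb I Q w" if "(P, Q) \<in> ?S" "weak_barb I P w" for P Q w
    using that barbed_bisimilarity_weak_barb[of "ResHo P" "ResHo Q" I w]
    by (simp add: weak_barb_ResHo_iff)
  moreover have "sym ?S"
    by (auto intro!: symI barbed_bisimilarity_sym)
  ultimately have "barbed_bisimulation I ?S"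
    unfolding barbed_bisimulation_def by blast
  with assms show ?thesis
    unfolding barbed_bisimilarity_def by blast
qed

lemma barbed_bisimilarity_close:
  "(close \<mu> P, close \<mu> Q) \<in> barbed_bisimilarity I \<Longrightarrow> (P, Q) \<in> barbed_bisimilarity I"
  by (auto simp: close_def barbed_bisimilarity_ResHo split: if_splits)

section \<open>Thread ownership\<close>

text \<open>
  \<open>owns P c\<close> abstracts \<open>\<Delta> \<turnstile> P\<close> to the truth value \<open>c\<close> of \<open>Cur \<in> dom \<Delta>\<close>.
\<close>

primrec owns :: "('f, 'v) proc \<Rightarrow> bool \<Rightarrow> bool" where
  "owns (Inp \<alpha> P) c \<longleftrightarrow> (c \<longleftrightarrow> (\<exists>h. \<alpha> = FoIn h)) \<and> owns P True"
| "owns (HoOut a e P) c \<longleftrightarrow> c \<and> owns P False"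
| "owns (FoOut h e P) c \<longleftrightarrow> \<not> c \<and> owns P False"
| "owns (Success w P) c \<longleftrightarrow> True"
| "owns (Repl \<alpha> P) c \<longleftrightarrow> \<not> c \<and> (\<nexists>h. \<alpha> = FoIn h) \<and> owns P True"
| "owns (Par P Q) c \<longleftrightarrow> owns P c \<and> owns Q False \<or> owns P False \<and> owns Q c"
| "owns (ResHo P) c \<longleftrightarrow> owns P c"
| "owns (ResFo P) c \<longleftrightarrow> owns P c"
| "owns Zero c \<longleftrightarrow> \<not> c"
| "owns (Sum P Q) c \<longleftrightarrow> owns P c \<and> owns Q c"
| "owns (Cond e f P Q) c \<longleftrightarrow> owns P c \<and> owns Q c"

lemma Cur_drop_cur [simp]: "drop_cur V \<Gamma> Cur = None"
  by (simp add: drop_cur_def shift_vis_def erase_def)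

lemma Cur_give_cur [simp]: "give_cur V \<Gamma> Cur = Some (Suc ` V \<union> {0})"
  by (simp add: give_cur_def)

lemma Cur_union_vis: "union_vis \<Delta>1 \<Delta>2 Cur = None \<longleftrightarrow> \<Delta>1 Cur = None \<and> \<Delta>2 Cur = None"
  by (auto simp: union_vis_def split: option.splits)

lemma typing_owns: "\<Delta> \<turnstile> P \<Longrightarrow> owns P (Cur \<in> dom \<Delta>)"
proof (induction rule: typing.induct)
  case (T_ResHo \<Delta>' \<Delta> P)
  \<comment> \<open>Erasing or shifting names alters what \<open>Cur\<close> sees, not whether
    \<open>Cur\<close> is in the domain.\<close>
  have "erase (Nm 0) \<Delta>' Cur = shift_vis \<Delta> Cur"
    using T_ResHo.hyps by simp
  then have "Cur \<in> dom \<Delta>' \<longleftrightarrow> Cur \<in> dom \<Delta>"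
    by (cases "\<Delta> Cur"; cases "\<Delta>' Cur") (auto simp: erase_def shift_vis_def)
  with T_ResHo show ?case by simp
next
  case (T_Par \<Delta>1 \<Delta>2 \<Delta> P1 P2)
  then have "Cur \<in> dom \<Delta> \<longleftrightarrow> Cur \<in> dom \<Delta>1 \<or> Cur \<in> dom \<Delta>2" "\<not> (Cur \<in> dom \<Delta>1 \<and> Cur \<in> dom \<Delta>2)"
    using Cur_union_vis[of \<Delta>1 \<Delta>2] by (auto simp: split_def domIff)
  with T_Par show ?case by (cases "Cur \<in> dom \<Delta>1") auto
qed (auto simp: domIff)

lemma owns_ren [simp]: "owns (ren r P) c = owns P c"
proof (induction P arbitrary: r c)
  case (Inp \<alpha> P)
  then show ?case by (cases \<alpha>) auto
next
  case (Repl \<alpha> P)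
  then show ?case by (cases \<alpha>) auto
qed auto

lemma owns_subst [simp]: "owns (subst k v P) c = owns P c"
  by (induction P arbitrary: k c) auto

lemma owns_beside [simp]: "owns (beside \<mu> P) c = owns P c"
  by (simp add: beside_def shift_def)

lemma owns_swap01 [simp]: "owns (swap01 P) c = owns P c"
  by (simp add: swap01_def)

text \<open>
  Nothing is claimed for \<open>AHoIn\<close> and \<open>AFoOut\<close> when \<open>c\<close> holds: a passive component of an owner may perform
  them, but no compatible observer allows this.
\<close>

primrec owner_ok :: "'v action \<Rightarrow> bool \<Rightarrow> ('f, 'v) proc \<Rightarrow> bool" where
  "owner_ok Tau c P \<longleftrightarrow> c \<and> owns P True"
| "owner_ok (AHoIn a v) c P \<longleftrightarrow> (\<not> c \<longrightarrow> owns P True)"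
| "owner_ok (AHoOut a v) c P \<longleftrightarrow> c \<and> owns P False"
| "owner_ok (AFoIn h v) c P \<longleftrightarrow> c \<and> owns P True"
| "owner_ok (AFoOut h v) c P \<longleftrightarrow> (\<not> c \<longrightarrow> owns P False)"
| "owner_ok (ASuccess w) c P \<longleftrightarrow> True"

text \<open>In a communication the performer of \<open>AHoOut\<close> or \<open>AFoIn\<close> must
  own the thread, so the other partner is passive and the composite was the owner. Higher-order
  communication hands the thread over, first-order communication leaves it in place.\<close>

lemma step_owner_ok: "step I P \<mu> P' \<Longrightarrow> owns P c \<Longrightarrow> owner_ok \<mu> c P'"
proof (induction arbitrary: c rule: step.induct)
  case (Repl \<alpha> P \<mu> P')
  then have "owner_ok \<mu> False P'" by (cases \<alpha>) auto
  with Repl show ?case by (cases \<mu>) auto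
next
  case (ResHo P \<mu> P')
  then show ?case by (cases \<mu>) auto
next
  case (ResFo P \<mu> P')
  then show ?case by (cases \<mu>) auto
next
  case (ParL P \<mu> P' Q)
  have "owns P c \<and> owns Q False \<or> owns P False \<and> owns Q c" using ParL.prems by simp
  then show ?case using ParL.IH[of c] ParL.IH[of False] by (cases \<mu>; cases c) auto
next
  case (ParR Q \<mu> Q' P)
  have "owns P c \<and> owns Q False \<or> owns P False \<and> owns Q c" using ParR.prems by simp
  then show ?case using ParR.IH[of c] ParR.IH[of False] by (cases \<mu>; cases c) auto
next
  case (HoComL P a v P' Q Q')
  then show ?case by (cases c) fastforce+
next
  case (HoComR P a v P' Q Q')
  then show ?case by (cases c) fastforce+
next
  case (FoComL P a v P' Q Q')
  then show ?case by (cases c) fastforce+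
next
  case (FoComR P a v P' Q Q')
  then show ?case by (cases c) fastforce+
qed auto

section \<open>Type-allowed transitions\<close>

primrec next_owner :: "'v action \<Rightarrow> bool \<Rightarrow> bool" where
  "next_owner Tau c = c"
| "next_owner (AHoIn a v) c = True"
| "next_owner (AHoOut a v) c = False"
| "next_owner (AFoIn h v) c = c"
| "next_owner (AFoOut h v) c = c"
| "next_owner (ASuccess w) c = c"

lemma tstep_step: "tstep I \<Gamma> P \<mu> \<Gamma>' P' \<Longrightarrow> step I P \<mu> P'"
  by (auto elim: tstep.cases)

text \<open>Whether an action is allowed, and the visibility it leads to, depend on
  \<open>\<Gamma>\<close> and the label alone.\<close>

lemma tstep_transfer: "tstep I \<Gamma> P \<mu> \<Gamma>' P' \<Longrightarrow> step I Q \<mu> Q' \<Longrightarrow> tstep I \<Gamma> Q \<mu> \<Gamma>' Q'"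
  by (auto elim!: tstep.cases intro: tstep.intros)

lemma tstep_comm: "tstep I \<Gamma> P \<mu> \<Gamma>' P' \<Longrightarrow> \<mu> \<noteq> Tau \<Longrightarrow> is_comm \<mu>"
  by (auto elim: tstep.cases)

lemma tstep_Tau_iff: "tstep I \<Gamma> P Tau \<Gamma>' P' \<longleftrightarrow> \<Gamma>' = \<Gamma> \<and> Cur \<notin> dom \<Gamma> \<and> red I P P'"
  by (auto simp: red_def elim: tstep.cases intro: tstep.intros)

text \<open>\<open>AHoIn\<close> and \<open>AFoOut\<close>, on which \<open>owner_ok\<close> is
  silent for owners, are allowed only when the observer has the thread; then compatibility forces
  \<open>c\<close> to be false.\<close>

lemma tstep_owns:
  assumes "tstep I \<Gamma> P \<mu> \<Gamma>' P'" "owns P c" "\<not> (c \<and> Cur \<in> dom \<Gamma>)"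
  shows "owns P' (next_owner \<mu> c)"
  using assms(1) step_owner_ok[OF tstep_step[OF assms(1)] assms(2)] assms(3)
  by (cases rule: tstep.cases) (cases c; auto)+

lemma tstep_compatible:
  assumes "tstep I \<Gamma> P \<mu> \<Gamma>' P'" "\<not> (c \<and> Cur \<in> dom \<Gamma>)"
  shows "\<not> (next_owner \<mu> c \<and> Cur \<in> dom \<Gamma>')"
  using assms by (cases rule: tstep.cases) (auto simp: domIff)

lemma ttaus_owns:
  assumes "ttaus I \<Gamma> P P'" "owns P c" "\<not> (c \<and> Cur \<in> dom \<Gamma>)"
  shows "owns P' c"
  using assms(1) unfolding ttaus_def
  by (induction rule: rtranclp_induct) (use assms tstep_owns in fastforce)+

lemma wtstep_owns:
  assumes "wtstep I \<Gamma> P \<mu> \<Gamma>' P'" "owns P c" "\<not> (c \<and> Cur \<in> dom \<Gamma>)"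
  shows "owns P' (next_owner \<mu> c)"
proof (cases "\<mu> = Tau")
  case True
  with assms(1) have "ttaus I \<Gamma> P P'" by (simp add: wtstep_def)
  with True ttaus_owns[OF _ assms(2,3)] show ?thesis by simp
next
  case False
  then obtain P1 P2 where "ttaus I \<Gamma> P P1" and s: "tstep I \<Gamma> P1 \<mu> \<Gamma>' P2" and "ttaus I \<Gamma>' P2 P'"
    using assms(1) by (auto simp: wtstep_def)
  moreover have "owns P1 c" using calculation assms ttaus_owns by blast
  then have "owns P2 (next_owner \<mu> c)" using s assms(3) tstep_owns by blast
  ultimately show ?thesis
    using ttaus_owns tstep_compatible[OF s assms(3)] by blast
qed

text \<open>If the observer has the thread, no typed \<open>Tau\<close> step is allowed; but then
  the process is passive, cannot reduce, and the sequence is empty.\<close>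

lemma reds_ttaus:
  assumes "(red I)\<^sup>*\<^sup>* P P'" "owns P c" "\<not> (c \<and> Cur \<in> dom \<Gamma>)"
  shows "ttaus I \<Gamma> P P'"
proof (cases "Cur \<in> dom \<Gamma>")
  case False
  then show ?thesis
    using assms(1) by (simp add: ttaus_def tstep_Tau_iff)
next
  case True
  with assms(2,3) have "owns P False" by auto
  then have "\<not> red I P P''" for P''
    using step_owner_ok[of I P Tau] by (auto simp: red_def)
  then have "P' = P"
    using assms(1) by (metis converse_rtranclpE)
  then show ?thesis by (simp add: ttaus_def)
qed

section \<open>Derivatives and image-finiteness\<close>

lemma derivative_ttaus:
  assumes "ttaus I \<Gamma> P P'" shows "derivative I (\<Gamma>, P) (\<Gamma>, P')"
  using assms unfolding ttaus_def
proof (induction rule: rtranclp_induct)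
  case base
  show ?case by (simp add: derivative_def)
next
  case (step Y Z)
  then show ?case
    unfolding derivative_def by (auto intro: rtranclp.rtrancl_into_rtrancl)
qed

lemma derivative_tstep: "tstep I \<Gamma> P \<mu> \<Gamma>' P' \<Longrightarrow> derivative I (\<Gamma>, P) (\<Gamma>', P')"
  unfolding derivative_def by (rule r_into_rtranclp) auto

lemma derivative_trans: "derivative I X Y \<Longrightarrow> derivative I Y Z \<Longrightarrow> derivative I X Z"
  unfolding derivative_def by (rule rtranclp_trans)

lemma derivative_wtstep:
  assumes "wtstep I \<Gamma> P \<mu> \<Gamma>' P'" shows "derivative I (\<Gamma>, P) (\<Gamma>', P')"
proof (cases "\<mu> = Tau")
  case True
  with assms derivative_ttaus show ?thesis by (auto simp: wtstep_def)
next
  case False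
  with assms show ?thesis
    unfolding wtstep_def by (metis derivative_trans derivative_ttaus derivative_tstep)
qed

lemma image_finite_derivative:
  "image_finite I \<Gamma> P \<Longrightarrow> derivative I (\<Gamma>, P) (\<Gamma>', P') \<Longrightarrow> image_finite I \<Gamma>' P'"
  unfolding image_finite_def using derivative_trans by blast

lemma image_finite_answers:
  assumes "image_finite I \<Gamma> P" shows "finite {P'. wtstep I \<Gamma> P \<mu> \<Gamma>' P'}"
proof -
  have "derivative I (\<Gamma>, P) (\<Gamma>, P)" by (simp add: derivative_def)
  then have "finite {(\<Gamma>'', P''). wtstep I \<Gamma> P \<mu> \<Gamma>'' P''}"
    using assms unfolding image_finite_def by blast
  then have "finite (snd ` {(\<Gamma>'', P''). wtstep I \<Gamma> P \<mu> \<Gamma>'' P''})" by simp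
  moreover have "{P'. wtstep I \<Gamma> P \<mu> \<Gamma>' P'} \<subseteq> snd ` {(\<Gamma>'', P''). wtstep I \<Gamma> P \<mu> \<Gamma>'' P''}"
    by force
  ultimately show ?thesis by (rule rev_finite_subset)
qed

section \<open>Answers of a process beside an observer\<close>

text \<open>While the barb \<open>w\<close> persists, the observer \<open>S\<close> has not taken part in any reduction.\<close>

lemma reds_Par_barb:
  assumes "(red I)\<^sup>*\<^sup>* (Par Q S) Z" "weak_barb I Z w" "w \<notin> succ_names Q"
    and lose: "\<And>\<mu> S'. step I S \<mu> S' \<Longrightarrow> w \<notin> succ_names S'"
  obtains Q' where "Z = Par Q' S" "(red I)\<^sup>*\<^sup>* Q Q'"
proof -
  \<comment> \<open>Success names only shrink along reductions, so \<open>w\<close> once lost never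
    returns.\<close>
  have "(\<exists>Q'. Z = Par Q' S \<and> (red I)\<^sup>*\<^sup>* Q Q') \<or> w \<notin> succ_names Z"
    using assms(1)
  proof (induction rule: rtranclp_induct)
    case (step Y Z)
    show ?case
    proof (cases "w \<in> succ_names Y")
      case False
      then show ?thesis
        using step.hyps(2) step_succ_names[of I Y Tau Z] by (auto simp: red_def)
    next
      case True
      then obtain Q' where Y: "Y = Par Q' S" and Q': "(red I)\<^sup>*\<^sup>* Q Q'"
        using step.IH by blast
      have w: "w \<notin> succ_names Q'"
        using reds_succ_names[OF Q'] assms(3) by blast
      have "red I (Par Q' S) Z" using step.hyps(2) Y by simp
      then show ?thesis
      proof (cases rule: red_Par_cases)
        case (left Q'')
        with Q' show ?thesis by (auto intro: rtranclp.rtrancl_into_rtrancl)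
      next
        case (right S')
        with w lose show ?thesis by (auto simp: red_def)
      next
        case (comm \<mu> Q'' S')
        then show ?thesis using w lose step_succ_names by fastforce
      qed
    qed
  qed auto
  then show ?thesis
    using weak_barb_succ_names[OF assms(2)] that by blast
qed

text \<open>\<open>Par P' S\<close> still has the barb \<open>w\<close>, so its answer has it too;
  hence \<open>S\<close> did not move and the answer is a reduction of \<open>Q\<close>
  alone.\<close>

lemma answer_Tau:
  assumes bb: "(Par P S, Par Q S) \<in> barbed_bisimilarity I"
    and "red I P P'" and S: "step I S (ASuccess w) S0"
    and "w \<notin> succ_names Q" and lose: "\<And>\<mu> S'. step I S \<mu> S' \<Longrightarrow> w \<notin> succ_names S'"
  obtains Q' where "(red I)\<^sup>*\<^sup>* Q Q'" "(Par P' S, Par Q' S) \<in> barbed_bisimilarity I"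
proof -
  obtain Z where Z: "(red I)\<^sup>*\<^sup>* (Par Q S) Z" and bb': "(Par P' S, Z) \<in> barbed_bisimilarity I"
    using barbed_bisimilarity_red[OF bb red_Par_left[OF assms(2)]] .
  have "weak_barb I Z w"
    using barbed_bisimilarity_weak_barb[OF bb'] weak_barb_step[OF step_Par_Success_right[OF S]] .
  then obtain Q' where "Z = Par Q' S" "(red I)\<^sup>*\<^sup>* Q Q'"
    using reds_Par_barb[OF Z _ assms(4)] lose by blast
  with bb' that show ?thesis by blast
qed

text \<open>
  The barb \<open>w\<^sub>0\<close> is available to \<open>S\<close> until it moves, so the answering process must make \<open>S\<close> move;
  the barb \<open>w\<close> is available only in \<open>S1\<close>, so \<open>S\<close> must move to \<open>S1\<close> and stay there.
\<close>

lemma answer_comm: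
  assumes bb: "(Par P S, Par Q S) \<in> barbed_bisimilarity I"
    and \<mu>: "is_comm \<mu>" and P: "step I P \<mu> P'" and S: "step I S (dual \<mu>) S1"
    and w0: "step I S (ASuccess w\<^sub>0) S0" "w\<^sub>0 \<notin> succ_names P'" "w\<^sub>0 \<notin> succ_names S1"
    and w: "step I S1 (ASuccess w) S2" "w \<notin> succ_names Q"
    and only: "\<And>\<mu>' S'. step I S \<mu>' S' \<Longrightarrow> \<mu>' = dual \<mu> \<and> S' = S1 \<or> w \<notin> succ_names S'"
    and lose: "\<And>\<mu>' S'. step I S1 \<mu>' S' \<Longrightarrow> w \<notin> succ_names S'"
  obtains Q1 Q2 Q' where "(red I)\<^sup>*\<^sup>* Q Q1" "step I Q1 \<mu> Q2" "(red I)\<^sup>*\<^sup>* Q2 Q'"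
    "(Par P' S1, Par Q' S1) \<in> barbed_bisimilarity I"
proof -
  \<comment> \<open>After the communication only the process \<open>X\<close> under
    \<open>close\<close> is tracked; that it is still a composition with \<open>S1\<close> follows
    at the end from the barb \<open>w\<close>.\<close>
  let ?moved = "\<lambda>Z. \<exists>Q1 Q2 X. (red I)\<^sup>*\<^sup>* Q Q1 \<and> step I Q1 \<mu> Q2 \<and> (red I)\<^sup>*\<^sup>* (Par Q2 S1) X \<and> Z = close \<mu> X"
  obtain Z where Z: "(red I)\<^sup>*\<^sup>* (Par Q S) Z"
    and bb': "(close \<mu> (Par P' S1), Z) \<in> barbed_bisimilarity I"
    using barbed_bisimilarity_red[OF bb red_Par_comm[OF \<mu> P S]] .
  have "weak_barb I (close \<mu> (Par P' S1)) w"
    using weak_barb_step[OF step_Par_Success_right[OF w(1)]] by (simp add: weak_barb_close_iff)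
  then have Zw: "weak_barb I Z w"
    using bb' barbed_bisimilarity_weak_barb by blast
  have "\<not> weak_barb I (close \<mu> (Par P' S1)) w\<^sub>0"
    using weak_barb_succ_names[of I "close \<mu> (Par P' S1)" w\<^sub>0] w0 by auto
  then have Zw0: "\<not> weak_barb I Z w\<^sub>0"
    using bb' barbed_bisimilarity_weak_barb barbed_bisimilarity_sym by blast
  \<comment> \<open>The observer is idle, has made the intended move, or has lost \<open>w\<close>
    for good.\<close>
  have "(\<exists>Q'. Z = Par Q' S \<and> (red I)\<^sup>*\<^sup>* Q Q') \<or> ?moved Z \<or> w \<notin> succ_names Z"
    using Z
  proof (induction rule: rtranclp_induct)
    case base
    show ?case by blast
  next
    case (step Y Z)
    consider (idle) Q' where "Y = Par Q' S" "(red I)\<^sup>*\<^sup>* Q Q'" | (moved) "?moved Y"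
      | (lost) "w \<notin> succ_names Y"
      using step.IH by blast
    then show ?case
    proof cases
      case idle
      have wQ': "w \<notin> succ_names Q'"
        using reds_succ_names[OF idle(2)] w(2) by blast
      have "red I (Par Q' S) Z" using step.hyps(2) idle by simp
      then show ?thesis
      proof (cases rule: red_Par_cases)
        case (left Q'')
        with idle show ?thesis by (auto intro: rtranclp.rtrancl_into_rtrancl)
      next
        case (right S')
        moreover have "Tau \<noteq> dual \<mu>" using \<mu> by (cases \<mu>) auto
        ultimately show ?thesis using wQ' only by (auto simp: red_def)
      next
        case (comm \<nu> Q'' S')
        show ?thesis
        proof (cases "w \<in> succ_names S'")
          case True
          then have "dual \<nu> = dual \<mu>" "S' = S1" using only comm by blast+
          then have "\<nu> = \<mu>" by (metis dual_dual)
          with comm \<open>S' = S1\<close> idle show ?thesis by blast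
        next
          case False
          with comm wQ' step_succ_names show ?thesis by fastforce
        qed
      qed
    next
      case moved
      then obtain Q1 Q2 X where X: "(red I)\<^sup>*\<^sup>* Q Q1" "step I Q1 \<mu> Q2" "(red I)\<^sup>*\<^sup>* (Par Q2 S1) X"
        and Y: "Y = close \<mu> X" by blast
      obtain X' where Z: "Z = close \<mu> X'" and "(red I)\<^sup>*\<^sup>* X X'"
        using reds_close[of I \<mu> X Z] step.hyps(2) Y by blast
      then have "(red I)\<^sup>*\<^sup>* (Par Q2 S1) X'"
        using X(3) by (meson rtranclp_trans)
      with X Z show ?thesis by blast
    next
      case lost
      then show ?thesis
        using step.hyps(2) step_succ_names[of I Y Tau Z] by (auto simp: red_def)
    qed
  qed
  \<comment> \<open>An idle \<open>S\<close> would still show \<open>w\<^sub>0\<close>.\<close>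
  moreover have "\<not> (\<exists>Q'. Z = Par Q' S)"
    using Zw0 weak_barb_step[OF step_Par_Success_right[OF w0(1)]] by blast
  moreover have "w \<in> succ_names Z"
    using Zw weak_barb_succ_names by blast
  ultimately obtain Q1 Q2 X where Q: "(red I)\<^sup>*\<^sup>* Q Q1" "step I Q1 \<mu> Q2"
    and X: "(red I)\<^sup>*\<^sup>* (Par Q2 S1) X" and ZX: "Z = close \<mu> X"
    by blast
  have "w \<notin> succ_names Q2"
    using reds_succ_names[OF Q(1)] step_succ_names[OF Q(2)] w(2) by blast
  moreover have "weak_barb I X w"
    using Zw ZX by (simp add: weak_barb_close_iff)
  ultimately obtain Q' where "X = Par Q' S1" "(red I)\<^sup>*\<^sup>* Q2 Q'"
    using reds_Par_barb[OF X] lose by blast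
  with that[OF Q] bb' ZX barbed_bisimilarity_close show ?thesis by blast
qed

section \<open>Observers\<close>

text \<open>A sum described by transitions only, so that the nesting and order of summands and
  decided conditionals are immaterial.\<close>

definition extends ::
  "('f \<Rightarrow> 'v list \<Rightarrow> 'v) \<Rightarrow> ('f, 'v) proc \<Rightarrow> ('f, 'v) proc \<Rightarrow> ('f, 'v) proc \<Rightarrow> bool" where
  "extends I S R T \<longleftrightarrow> (\<forall>\<mu> S'. step I S \<mu> S' \<longleftrightarrow> step I R \<mu> S' \<or> step I T \<mu> S')"

definition distinguishes ::
  "('f \<Rightarrow> 'v list \<Rightarrow> 'v) \<Rightarrow> ('f, 'v) proc \<Rightarrow> ('f, 'v) proc \<Rightarrow> ('f, 'v) proc \<Rightarrow> bool" where
  "distinguishes I R P Q \<longleftrightarrow>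
     (\<forall>S T. extends I S R T \<longrightarrow> succ_names T \<inter> succ_names R = {} \<longrightarrow>
        (Par P S, Par Q S) \<notin> barbed_bisimilarity I)"

definition observer :: "vis \<Rightarrow> nat set \<Rightarrow> ('f, 'v) proc \<Rightarrow> bool" where
  "observer \<Gamma> N R \<longleftrightarrow> \<Gamma> \<turnstile> R \<and> closed_proc R \<and> succ_names R \<inter> N = {}"

text \<open>Avoiding an arbitrary finite \<open>N\<close> allows observers for several pairs to be
  chosen with disjoint success names.\<close>

definition distinguishable ::
  "('f \<Rightarrow> 'v list \<Rightarrow> 'v) \<Rightarrow> vis \<Rightarrow> ('f, 'v) proc \<Rightarrow> ('f, 'v) proc \<Rightarrow> bool" where
  "distinguishable I \<Gamma> P Q \<longleftrightarrow>
     (\<forall>N. finite N \<longrightarrow> (\<exists>R. observer \<Gamma> N R \<and> distinguishes I R P Q))"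

lemma distinguishes_sym: "distinguishes I R P Q \<Longrightarrow> distinguishes I R Q P"
  unfolding distinguishes_def using barbed_bisimilarity_sym by blast

text \<open>Extending the sum by \<open>T\<close> extends each summand by the other one plus
  \<open>T\<close>, and names stay disjoint.\<close>

lemma distinguishes_Sum:
  fixes R1 R2 :: "('f, 'v) proc"
  assumes "succ_names R1 \<inter> succ_names R2 = {}"
  shows "distinguishes I R1 P Q \<Longrightarrow> distinguishes I (Sum R1 R2) P Q"
    and "distinguishes I R2 P Q \<Longrightarrow> distinguishes I (Sum R1 R2) P Q"
proof -
  have "extends I S R1 (Sum R2 T)" "extends I S R2 (Sum R1 T)" if "extends I S (Sum R1 R2) T" for S T
    using that unfolding extends_def by (auto simp: step_Sum_iff)
  moreover have "succ_names (Sum R2 T) \<inter> succ_names R1 = {}" "succ_names (Sum R1 T) \<inter> succ_names R2 = {}"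
    if "succ_names T \<inter> succ_names (Sum R1 R2) = {}" for T :: "('f, 'v) proc"
    using that assms by auto
  ultimately show "distinguishes I R1 P Q \<Longrightarrow> distinguishes I (Sum R1 R2) P Q"
    "distinguishes I R2 P Q \<Longrightarrow> distinguishes I (Sum R1 R2) P Q"
    unfolding distinguishes_def by blast+
qed

lemma common_observer:
  assumes "finite A" "\<And>Q. Q \<in> A \<Longrightarrow> distinguishable I \<Gamma> P Q" "finite N"
  obtains R where "observer \<Gamma> N R" "\<And>Q. Q \<in> A \<Longrightarrow> distinguishes I R P Q"
proof -
  have "\<exists>R. observer \<Gamma> N R \<and> (\<forall>Q\<in>A. distinguishes I R P Q)"
    using assms(1,2)
  proof (induction rule: finite_induct)
    case empty
    obtain w where "w \<notin> N" using assms(3) ex_new_if_finite infinite_UNIV_nat by blast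
    \<comment> \<open>Unlike \<open>Zero\<close>, this process is typable whether or not the
      observer has the thread.\<close>
    then have "observer \<Gamma> N (Success w Zero)"
      by (auto simp: observer_def closed_proc_def intro: typing.intros)
    then show ?case by blast
  next
    case (insert Q A)
    then obtain R2 where R2: "observer \<Gamma> N R2" "\<forall>Q\<in>A. distinguishes I R2 P Q" by blast
    have "finite (N \<union> succ_names R2)" using assms(3) finite_succ_names by blast
    then obtain R1 where R1: "observer \<Gamma> (N \<union> succ_names R2) R1" "distinguishes I R1 P Q"
      using insert.prems unfolding distinguishable_def by blast
    have "succ_names R1 \<inter> succ_names R2 = {}" using R1 by (auto simp: observer_def)
    then have "\<forall>Q\<in>insert Q A. distinguishes I (Sum R1 R2) P Q"
      using R1(2) R2(2) distinguishes_Sum by blast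
    moreover have "observer \<Gamma> N (Sum R1 R2)"
      using R1(1) R2(1) by (auto simp: observer_def closed_proc_def intro: typing.intros)
    ultimately show ?case by blast
  qed
  with that show ?thesis by blast
qed

text \<open>A fresh summand \<open>Success w Zero\<close> adds a barb signalling that the observer
  has not moved: every step discards it.\<close>

lemma common_barbed_observer:
  assumes "finite A" "\<And>Q. Q \<in> A \<Longrightarrow> distinguishable I \<Gamma> P Q" "finite N"
  obtains R w where "observer \<Gamma> N R" "\<And>Q. Q \<in> A \<Longrightarrow> distinguishes I R P Q"
    "step I R (ASuccess w) Zero" "\<And>\<mu> S. step I R \<mu> S \<Longrightarrow> w \<notin> succ_names S"
proof -
  obtain R where R: "observer \<Gamma> N R" "\<And>Q. Q \<in> A \<Longrightarrow> distinguishes I R P Q"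
    using common_observer[OF assms] by blast
  have "finite (N \<union> succ_names R)" using assms(3) finite_succ_names by blast
  then obtain w where w: "w \<notin> N \<union> succ_names R"
    using ex_new_if_finite infinite_UNIV_nat by blast
  show ?thesis
  proof
    show "observer \<Gamma> N (Sum (Success w Zero) R)"
      using R(1) w by (auto simp: observer_def closed_proc_def intro: typing.intros)
    show "distinguishes I (Sum (Success w Zero) R) P Q" if "Q \<in> A" for Q
      using R(2)[OF that] w by (intro distinguishes_Sum(2)) auto
    show "step I (Sum (Success w Zero) R) (ASuccess w) Zero"
      by (simp add: step_Sum_iff step_Success_iff)
    show "w \<notin> succ_names S" if "step I (Sum (Success w Zero) R) \<mu> S" for \<mu> S
      using that w step_succ_names[of I R \<mu> S] by (auto simp: step_Sum_iff step_Success_iff)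
  qed
qed

section \<open>Observers that test a single action\<close>

lemma closed_expr_mono: "closed_expr k e \<Longrightarrow> k \<le> j \<Longrightarrow> closed_expr j e"
  by (induction e) (auto simp: list_all_iff)

lemma closed_upto_mono: "closed_upto k P \<Longrightarrow> k \<le> j \<Longrightarrow> closed_upto j P"
  by (induction P arbitrary: k j) (auto intro: closed_expr_mono)

lemma subst_expr_closed: "closed_expr k e \<Longrightarrow> subst_expr k v e = e"
  by (induction e) (auto simp: list_all_iff intro: map_idI)

text \<open>Keeps an observer placed under an input prefix unchanged by the received value.\<close>

lemma subst_closed: "closed_upto k P \<Longrightarrow> subst k v P = P"
  by (induction P arbitrary: k) (auto simp: subst_expr_closed)

text \<open>
  \<open>S1\<close> is either \<open>R'\<close> or \<open>if v = v then R' else \<dots>\<close>, hence it is described only by its steps.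
\<close>

lemma prefix_observer:
  fixes R' :: "('f, 'v) proc" and I :: "'f \<Rightarrow> 'v list \<Rightarrow> 'v"
  assumes t: "tstep I \<Gamma> P \<mu> \<Gamma>' P'" and \<mu>: "\<mu> \<noteq> Tau" and R': "\<Gamma>' \<turnstile> R'" "closed_proc R'"
  obtains R S1 where "\<Gamma> \<turnstile> R" "closed_proc R" "succ_names R = insert w (succ_names R')"
    "step I R (dual \<mu>) S1" "extends I S1 R' Zero" "succ_names S1 = succ_names R'"
    "step I R (ASuccess w) Zero"
    "\<And>\<mu>' S'. step I R \<mu>' S' \<Longrightarrow> \<mu>' = dual \<mu> \<and> S' = S1 \<or> succ_names S' \<subseteq> {w}"
proof -
  let ?W = "Success w Zero :: ('f, 'v) proc"
  have cl: "closed_upto 0 R'" "closed_upto (Suc 0) R'"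
    using R'(2) closed_upto_mono by (auto simp: closed_proc_def)
  have ext: "extends I R' R' Zero" "extends I (Cond (Val v) (Val v) R' ?W) R' Zero" for v
    by (auto simp: extends_def step_Zero_iff step_Cond_Val_iff)
  have sb: "subst 0 u (Cond (Var 0) (Val v) R' ?W) = Cond (Val u) (Val v) R' ?W" for u v
    using cl by (simp add: subst_closed)
  have W: "\<Gamma>'' \<turnstile> ?W" for \<Gamma>'' by (rule T_Success)
  show ?thesis
    using t
  proof (cases rule: tstep.cases)
    case (1 a v V)
    \<comment> \<open>The observer's input may receive any value, so it is compared with
      \<open>v\<close>; any other value leads to \<open>?W\<close>, where only \<open>w\<close>
      remains.\<close>
    let ?B = "Cond (Var 0) (Val v) R' ?W"
    \<comment> \<open>The typing rule of the dual prefix types its continuation in exactly the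
      \<open>\<Gamma>'\<close> reached by the typed transition; likewise in the cases below.\<close>
    have "\<Gamma> \<turnstile> Inp (HoIn a) ?B"
      using 1 R' W by (intro T_HoIn T_Cond) auto
    moreover have "step I (Inp (HoIn a) ?B) \<mu>' S' \<longleftrightarrow>
        (\<exists>u. \<mu>' = AHoIn a u \<and> S' = Cond (Val u) (Val v) R' ?W)" for \<mu>' S'
      using step.HoIn[of I a ?B] sb by (auto elim: step_HoInE)
    ultimately show ?thesis
      using 1 W cl ext
      by (intro that[of "Sum ?W (Inp (HoIn a) ?B)" "Cond (Val v) (Val v) R' ?W"])
        (auto simp: closed_proc_def step_Sum_iff step_Success_iff intro: T_Sum split: if_splits)
  next
    case (2 a v V)
    have "\<Gamma> \<turnstile> HoOut a (Val v) R'"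
      using 2 R' by (auto intro: T_HoOut)
    moreover have "step I (HoOut a (Val v) R') \<mu>' S' \<longleftrightarrow> \<mu>' = AHoOut a v \<and> S' = R'" for \<mu>' S'
      by (auto elim: step_HoOutE intro: step.HoOut)
    ultimately show ?thesis
      using 2 W cl ext
      by (intro that[of "Sum ?W (HoOut a (Val v) R')" R'])
        (auto simp: closed_proc_def step_Sum_iff step_Success_iff intro: T_Sum split: if_splits)
  next
    case (3 h v)
    let ?B = "Cond (Var 0) (Val v) R' ?W"
    have "\<Gamma> \<turnstile> Inp (FoIn h) ?B"
      using 3 R' W by (intro T_FoIn T_Cond) auto
    moreover have "step I (Inp (FoIn h) ?B) \<mu>' S' \<longleftrightarrow>
        (\<exists>u. \<mu>' = AFoIn h u \<and> S' = Cond (Val u) (Val v) R' ?W)" for \<mu>' S'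
      using step.FoIn[of I h ?B] sb by (auto elim: step_FoInE)
    ultimately show ?thesis
      using 3 W cl ext
      by (intro that[of "Sum ?W (Inp (FoIn h) ?B)" "Cond (Val v) (Val v) R' ?W"])
        (auto simp: closed_proc_def step_Sum_iff step_Success_iff intro: T_Sum split: if_splits)
  next
    case (4 h v)
    have "\<Gamma> \<turnstile> FoOut h (Val v) R'"
      using 4 R' by (auto intro: T_FoOut)
    moreover have "step I (FoOut h (Val v) R') \<mu>' S' \<longleftrightarrow> \<mu>' = AFoOut h v \<and> S' = R'" for \<mu>' S'
      by (auto elim: step_FoOutE intro: step.FoOut)
    ultimately show ?thesis
      using 4 W cl ext
      by (intro that[of "Sum ?W (FoOut h (Val v) R')" R'])
        (auto simp: closed_proc_def step_Sum_iff step_Success_iff intro: T_Sum split: if_splits)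
  next
    case 5
    with \<mu> show ?thesis by simp
  qed
qed

text \<open>One observer \<open>R'\<close> handles all answers. It serves as it is if
  \<open>\<mu>\<close> is \<open>Tau\<close>, and otherwise behind the prefix dual to
  \<open>\<mu>\<close>. Bisimilar composites would yield a type-allowed answer that
  \<open>R'\<close> fails to tell from \<open>P'\<close>.\<close>

lemma distinguishable_step:
  assumes t: "tstep I \<Gamma> P \<mu> \<Gamma>' P'"
    and fin: "finite {Q'. wtstep I \<Gamma> Q \<mu> \<Gamma>' Q'}"
    and ans: "\<And>Q'. wtstep I \<Gamma> Q \<mu> \<Gamma>' Q' \<Longrightarrow> distinguishable I \<Gamma>' P' Q'"
    and Q: "owns Q c" and c: "\<not> (c \<and> Cur \<in> dom \<Gamma>)"
  shows "distinguishable I \<Gamma> P Q"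
  unfolding distinguishable_def
proof (intro allI impI)
  fix N0 :: "nat set" assume "finite N0"
  \<comment> \<open>With the names of \<open>P\<close> and \<open>Q\<close> avoided, the barbs
    \<open>w\<close> and \<open>w0\<close> can only come from the observer.\<close>
  define N where "N = N0 \<union> succ_names P \<union> succ_names Q"
  have "finite N"
    using \<open>finite N0\<close> by (simp add: N_def finite_succ_names)
  let ?A = "{Q'. wtstep I \<Gamma> Q \<mu> \<Gamma>' Q'}"
  have "distinguishable I \<Gamma>' P' Q'" if "Q' \<in> ?A" for Q'
    using that ans by simp
  from common_barbed_observer[OF fin this \<open>finite N\<close>]
  obtain R' w where R': "observer \<Gamma>' N R'"
    and dist: "\<And>Q'. Q' \<in> ?A \<Longrightarrow> distinguishes I R' P' Q'"
    and w: "step I R' (ASuccess w) Zero" and lose: "\<And>\<nu> S. step I R' \<nu> S \<Longrightarrow> w \<notin> succ_names S"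
    by metis
  have wR': "w \<in> succ_names R'" using w step_Success_names by blast
  have wN: "w \<notin> N" using wR' R' by (auto simp: observer_def)
  show "\<exists>R. observer \<Gamma> N0 R \<and> distinguishes I R P Q"
  proof (cases "\<mu> = Tau")
    case True
    have \<Gamma>': "\<Gamma>' = \<Gamma>" and red: "red I P P'"
      using t True by (auto simp: tstep_Tau_iff)
    have "distinguishes I R' P Q"
      unfolding distinguishes_def
    proof (intro allI impI notI)
      fix S T assume S: "extends I S R' T" "succ_names T \<inter> succ_names R' = {}"
        and bb: "(Par P S, Par Q S) \<in> barbed_bisimilarity I"
      have "step I S (ASuccess w) Zero" using S(1) w by (simp add: extends_def)
      \<comment> \<open>A step of \<open>S\<close> comes either from \<open>R'\<close>, which drops
        \<open>w\<close>, or from \<open>T\<close>, which never had it.\<close>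
      moreover have "w \<notin> succ_names S'" if "step I S \<nu> S'" for \<nu> S'
        using that S wR' lose step_succ_names[of I T \<nu> S'] unfolding extends_def by blast
      moreover have "w \<notin> succ_names Q" using wN by (simp add: N_def)
      ultimately obtain Q' where "(red I)\<^sup>*\<^sup>* Q Q'" "(Par P' S, Par Q' S) \<in> barbed_bisimilarity I"
        using answer_Tau[OF bb red] by blast
      moreover have "wtstep I \<Gamma> Q \<mu> \<Gamma>' Q'"
        using calculation reds_ttaus[OF _ Q c] True \<Gamma>' by (simp add: wtstep_def)
      ultimately show False
        using dist S unfolding distinguishes_def by blast
    qed
    then show ?thesis using R' \<Gamma>' by (auto simp: observer_def N_def)
  next
    case False
    have "finite (N \<union> succ_names R')" using \<open>finite N\<close> finite_succ_names by blast
    then obtain w0 where w0: "w0 \<notin> N \<union> succ_names R'"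
      using ex_new_if_finite infinite_UNIV_nat by blast
    obtain R S1 where R: "\<Gamma> \<turnstile> R" "closed_proc R" "succ_names R = insert w0 (succ_names R')"
      and S1: "step I R (dual \<mu>) S1" "extends I S1 R' Zero" "succ_names S1 = succ_names R'"
      and Rw0: "step I R (ASuccess w0) Zero"
      and only: "\<And>\<mu>' S'. step I R \<mu>' S' \<Longrightarrow> \<mu>' = dual \<mu> \<and> S' = S1 \<or> succ_names S' \<subseteq> {w0}"
      using prefix_observer[OF t False, of R' w0] R' unfolding observer_def by blast
    have P: "step I P \<mu> P'" using t by (rule tstep_step)
    have ww0: "w \<noteq> w0" using w0 wR' by blast
    have "distinguishes I R P Q"
      unfolding distinguishes_def
    proof (intro allI impI notI)
      fix S T assume S: "extends I S R T" "succ_names T \<inter> succ_names R = {}"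
        and bb: "(Par P S, Par Q S) \<in> barbed_bisimilarity I"
      have "step I S (dual \<mu>) S1" "step I S (ASuccess w0) Zero"
        using S(1) S1(1) Rw0 by (auto simp: extends_def)
      moreover have "w0 \<notin> succ_names P'" "w0 \<notin> succ_names S1"
        using w0 step_succ_names[OF P] S1(3) by (auto simp: N_def)
      moreover have "step I S1 (ASuccess w) Zero" "w \<notin> succ_names Q"
        using S1(2) w wN by (auto simp: extends_def N_def)
      moreover have "\<mu>' = dual \<mu> \<and> S' = S1 \<or> w \<notin> succ_names S'" if SS': "step I S \<mu>' S'" for \<mu>' S'
      proof -
        consider "step I R \<mu>' S'" | "step I T \<mu>' S'"
          using SS' S(1) by (auto simp: extends_def)
        then show ?thesis
        proof cases
          case 1
          with only[OF 1] ww0 show ?thesis by blast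
        next
          case 2
          then have "succ_names S' \<subseteq> succ_names T" by (rule step_succ_names)
          with S(2) R(3) wR' show ?thesis by blast
        qed
      qed
      moreover have "w \<notin> succ_names S'" if "step I S1 \<mu>' S'" for \<mu>' S'
        using that S1(2) lose by (auto simp: extends_def step_Zero_iff)
      ultimately obtain Q1 Q2 Q' where Q12: "(red I)\<^sup>*\<^sup>* Q Q1" "step I Q1 \<mu> Q2" "(red I)\<^sup>*\<^sup>* Q2 Q'"
        and bb': "(Par P' S1, Par Q' S1) \<in> barbed_bisimilarity I"
        using answer_comm[OF bb tstep_comm[OF t False] P] by metis
      \<comment> \<open>Ownership turns the untyped answer into a typed weak transition.\<close>
      have q1: "ttaus I \<Gamma> Q Q1" using Q12(1) Q c by (rule reds_ttaus)
      have q2: "tstep I \<Gamma> Q1 \<mu> \<Gamma>' Q2" using t Q12(2) by (rule tstep_transfer)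
      have "owns Q2 (next_owner \<mu> c)"
        using tstep_owns[OF q2 ttaus_owns[OF q1 Q c] c] .
      then have "ttaus I \<Gamma>' Q2 Q'"
        using reds_ttaus[OF Q12(3)] tstep_compatible[OF t c] by blast
      then have "wtstep I \<Gamma> Q \<mu> \<Gamma>' Q'"
        using q1 q2 False by (auto simp: wtstep_def)
      then have "distinguishes I R' P' Q'" using dist by simp
      then show False
        using bb' S1(2) unfolding distinguishes_def by (metis succ_names.simps(9) inf_bot_left)
    qed
    moreover have "observer \<Gamma> N0 R"
      using R R' w0 by (auto simp: observer_def N_def)
    ultimately show ?thesis by blast
  qed
qed

section \<open>Apartness\<close>

text \<open>The rule \<open>swap\<close> accounts for the symmetric clause of a typed
  bisimulation.\<close>

inductive apart ::
  "('f \<Rightarrow> 'v list \<Rightarrow> 'v) \<Rightarrow> vis \<Rightarrow> ('f, 'v) proc \<Rightarrow> ('f, 'v) proc \<Rightarrow> bool"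
  for I :: "'f \<Rightarrow> 'v list \<Rightarrow> 'v" where
  move: "tstep I \<Gamma> P \<mu> \<Gamma>' P' \<Longrightarrow> (\<And>Q'. wtstep I \<Gamma> Q \<mu> \<Gamma>' Q' \<Longrightarrow> apart I \<Gamma>' P' Q') \<Longrightarrow> apart I \<Gamma> P Q"
| swap: "apart I \<Gamma> Q P \<Longrightarrow> apart I \<Gamma> P Q"

text \<open>If a bisimulation clause failed for a pair, \<open>move\<close>, for the second clause
  between two uses of \<open>swap\<close>, would make the pair apart.\<close>

lemma not_apart_typed_bisimilarity:
  assumes "\<not> apart I \<Gamma> P Q" shows "(\<Gamma>, P, Q) \<in> typed_bisimilarity I"
proof -
  have "typed_bisimulation I {(\<Gamma>, P, Q). \<not> apart I \<Gamma> P Q}"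
    unfolding typed_bisimulation_def by (auto; meson apart.move apart.swap)
  with assms show ?thesis unfolding typed_bisimilarity_def by blast
qed

text \<open>The thread may change hands along the moves, so \<open>c\<close> is generalised;
  ownership, compatibility and image-finiteness pass to derivatives.\<close>

lemma apart_distinguishable:
  assumes "apart I \<Gamma> P Q" "owns P c" "owns Q c" "\<not> (c \<and> Cur \<in> dom \<Gamma>)"
    "image_finite I \<Gamma> P" "image_finite I \<Gamma> Q"
  shows "distinguishable I \<Gamma> P Q"
  using assms
proof (induction arbitrary: c rule: apart.induct)
  case (move \<Gamma> P \<mu> \<Gamma>' P' Q)
  show ?case
  proof (rule distinguishable_step[OF move.hyps(1) image_finite_answers[OF move.prems(5)] _ move.prems(2,3)])
    fix Q' assume Q': "wtstep I \<Gamma> Q \<mu> \<Gamma>' Q'"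
    show "distinguishable I \<Gamma>' P' Q'"
      using Q'
    proof (rule move.IH)
      show "owns P' (next_owner \<mu> c)" using tstep_owns move by blast
      show "owns Q' (next_owner \<mu> c)" using wtstep_owns move Q' by blast
      show "\<not> (next_owner \<mu> c \<and> Cur \<in> dom \<Gamma>')" using tstep_compatible move by blast
      show "image_finite I \<Gamma>' P'" using image_finite_derivative derivative_tstep move by blast
      show "image_finite I \<Gamma>' Q'" using image_finite_derivative derivative_wtstep move Q' by blast
    qed
  qed
next
  case (swap \<Gamma> Q P)
  have "distinguishable I \<Gamma> Q P"
    by (rule swap.IH[OF swap.prems(2,1,3,5,4)])
  then show ?case unfolding distinguishable_def using distinguishes_sym by blast
qed

theorem mainTheorem10:
  fixes I :: "'f \<Rightarrow> 'v list \<Rightarrow> 'v"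
    and \<Delta> \<Gamma> :: vis
    and P Q :: "('f, 'v) proc"
  assumes "visibility \<Delta>" and "visibility \<Gamma>" and "compatible \<Delta> \<Gamma>"
    and "closed_proc P" and "closed_proc Q"
    and "image_finite I \<Gamma> P" and "image_finite I \<Gamma> Q"
    and "\<Delta> \<turnstile> P" and "\<Delta> \<turnstile> Q"
    and "barbed_equivalent I \<Gamma> P Q"
  shows "typed_bisimilar I \<Delta> \<Gamma> P Q"
proof -
  have "\<not> apart I \<Gamma> P Q"
  proof
    assume "apart I \<Gamma> P Q"
    moreover have "\<not> (Cur \<in> dom \<Delta> \<and> Cur \<in> dom \<Gamma>)"
      using assms(3) by (auto simp: compatible_def)
    ultimately have "distinguishable I \<Gamma> P Q"
      using apart_distinguishable assms(6,7) typing_owns[OF assms(8)] typing_owns[OF assms(9)] by blast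
    then obtain R where "\<Gamma> \<turnstile> R" "closed_proc R" and R: "distinguishes I R P Q"
      unfolding distinguishable_def observer_def by blast
    then have "(Par P R, Par Q R) \<in> barbed_bisimilarity I"
      using assms(10) by (simp add: barbed_equivalent_def)
    \<comment> \<open>The observer alone is its own extension by an empty summand.\<close>
    moreover have "extends I R R Zero" by (simp add: extends_def step_Zero_iff)
    ultimately show False
      using R unfolding distinguishes_def by (metis succ_names.simps(9) inf_bot_left)
  qed
  then show ?thesis
    using not_apart_typed_bisimilarity assms(3) by (simp add: typed_bisimilar_def)
qed

end
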